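(* Let $G$ be a finite simple $2$-connected $3$-$\gamma$-vertex critical claw-free graph. Then $G$ is Hamiltonian.
   Context: $\gamma(G)$ denotes the domination number of $G$ (minimum size of a set $D \subseteq V(G)$ such that every vertex outside $D$ has a neighbor in $D$). A graph $G$ is $k$-$\gamma$-vertex critical if $\gamma(G)=k$ and $\gamma(G-v)<k$ for every vertex $v$ of $G$. A graph is claw-free if it has no induced subgraph isomorphic to $K_{1,3}$. *)

theory Defs
  imports "Graph_Theory.Kuratowski"
begin

text \<open>
  A finite simple undirected graph is a symmetric, loop-free digraph without parallel arcs on a
  finite vertex set, as captured by the locale \<^locale>\<open>graph\<close>. Each undirected edge is
  represented by its two orientations, so \<open>u \<rightarrow>\<^bsub>G\<^esub> v\<close> is adjacency.
\<close>

definition dominating_set :: "('a, 'b) pre_digraph \<Rightarrow> 'a set \<Rightarrow> bool" where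
  "dominating_set G D \<longleftrightarrow> D \<subseteq> verts G \<and> (\<forall>v \<in> verts G - D. \<exists>u \<in> D. v \<rightarrow>\<^bsub>G\<^esub> u)"

definition domination_number :: "('a, 'b) pre_digraph \<Rightarrow> nat" where
  "domination_number G = (LEAST n. \<exists>D. dominating_set G D \<and> finite D \<and> card D = n)"

definition domination_vertex_critical :: "nat \<Rightarrow> ('a, 'b) pre_digraph \<Rightarrow> bool" where
  "domination_vertex_critical k G \<longleftrightarrow>
     domination_number G = k \<and>
     (\<forall>v \<in> verts G. domination_number (pre_digraph.del_vert G v) < k)"

text \<open>
  The predicate \<^const>\<open>complete_bipartite_digraph\<close> characterises its argument up to isomorphism.
\<close>

definition claw_free :: "('a, 'b) pre_digraph \<Rightarrow> bool" where
  "claw_free G \<longleftrightarrow> \<not> (\<exists>H. induced_subgraph H G \<and> complete_bipartite_digraph 1 3 H)"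

definition k_connected :: "nat \<Rightarrow> ('a, 'b) pre_digraph \<Rightarrow> bool" where
  "k_connected k G \<longleftrightarrow>
     k < card (verts G) \<and>
     (\<forall>S \<subseteq> verts G. finite S \<and> card S < k \<longrightarrow> connected (G \<restriction> (verts G - S)))"

text \<open>
  The bound on the length is needed because in a symmetric digraph the closed walk that runs
  along one edge and back counts as a \<^const>\<open>pre_digraph.cycle\<close>.
\<close>

definition hamiltonian :: "('a, 'b) pre_digraph \<Rightarrow> bool" where
  "hamiltonian G \<longleftrightarrow>
     (\<exists>p. pre_digraph.cycle G p \<and> 3 \<le> length p \<and> tail G ` set p = verts G)"

end

theory Submission
  imports Defs
begin

text \<open>
  Let \<open>C\<close> be a longest cycle, \<open>R\<close> a component of \<open>G - C\<close>, and let \<open>x\<close>, \<open>y\<close> be two attachments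
  of \<open>R\<close> on \<open>C\<close>. Rerouting \<open>C\<close> through \<open>R\<close> shows that no vertex dominates all four cycle
  neighbours of \<open>x\<close> and \<open>y\<close>. For \<open>v \<in> R\<close> criticality gives two vertices that dominate
  everything except \<open>v\<close>, and so \<open>R\<close> has exactly two attachments \<open>x\<close>, \<open>y\<close> and consists of
  one vertex or of two adjacent vertices; in other words \<open>x\<close> and \<open>y\<close> are joined by a path whose
  one or two inner vertices have degree two in \<open>G\<close>. The dominating pairs belonging to the
  vertices of this path then split the rest of \<open>G\<close> into a few cliques, along which a Hamiltonian
  path from a neighbour of \<open>x\<close> to a neighbour of \<open>y\<close> can be written down.
\<close>

section \<open>Cycles and paths of a finite simple graph given by its adjacency relation\<close>

locale finite_simple_graph =
  fixes V :: "'a set" and E :: "'a \<Rightarrow> 'a \<Rightarrow> bool"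
  assumes finite_V: "finite V"
    and E_sym: "E u v \<Longrightarrow> E v u"
    and E_irrefl: "\<not> E v v"
    and E_V: "E u v \<Longrightarrow> u \<in> V \<and> v \<in> V"
begin

lemma E_commute: "E u v \<longleftrightarrow> E v u"
  using E_sym by blast

lemma flip_E: "successively (\<lambda>u v. E v u) p \<longleftrightarrow> successively E p"
  by (simp add: E_commute cong: successively_cong)

text \<open>
  A single edge \<open>[u, v]\<close> counts as a cycle here, which makes a longest cycle exist trivially.
\<close>

definition cyc :: "'a list \<Rightarrow> bool" where
  "cyc c \<longleftrightarrow> c \<noteq> [] \<and> distinct c \<and> set c \<subseteq> V \<and> successively E c \<and> E (last c) (hd c)"

definition longest_cyc :: "'a list \<Rightarrow> bool" where
  "longest_cyc c \<longleftrightarrow> cyc c \<and> (\<forall>c'. cyc c' \<longrightarrow> length c' \<le> length c)"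

lemma longest_cycD: "longest_cyc c \<Longrightarrow> cyc c' \<Longrightarrow> length c < length c' \<Longrightarrow> False"
  by (auto simp: longest_cyc_def)

lemma longest_cyc_exists:
  assumes "E u v"
  obtains c where "longest_cyc c"
proof -
  have c: "cyc [u, v]"
    using assms E_V[OF assms] E_sym[OF assms] by (auto simp: cyc_def E_irrefl)
  have "\<forall>c. cyc c \<longrightarrow> length c \<le> card V"
    using card_mono[OF finite_V] by (metis cyc_def distinct_card)
  then obtain c where "cyc c \<and> (\<forall>c'. cyc c' \<longrightarrow> length c' \<le> length c)"
    using ex_has_greatest_nat[where P = cyc and f = length and b = "Suc (card V)", OF c]
    by (auto simp: less_Suc_eq_le)
  then show thesis
    using that by (auto simp: longest_cyc_def)
qed

lemma cyc_rotate: "cyc (as @ bs) \<longleftrightarrow> cyc (bs @ as)"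
  by (cases "as = []"; cases "bs = []") (auto simp: cyc_def successively_append_iff)

lemma longest_cyc_rotate: "longest_cyc (as @ bs) \<longleftrightarrow> longest_cyc (bs @ as)"
  by (simp add: longest_cyc_def cyc_rotate[of as bs] add.commute)

lemma cyc_rev: "cyc (rev c) \<longleftrightarrow> cyc c"
  by (auto simp: cyc_def flip_E hd_rev last_rev E_commute)

lemma longest_cyc_rev: "longest_cyc (rev c) \<longleftrightarrow> longest_cyc c"
  by (simp add: longest_cyc_def cyc_rev)

definition pth :: "'a set \<Rightarrow> 'a \<Rightarrow> 'a list \<Rightarrow> 'a \<Rightarrow> bool" where
  "pth A a p b \<longleftrightarrow> p \<noteq> [] \<and> distinct p \<and> set p \<subseteq> A \<and> successively E p \<and> hd p = a \<and> last p = b"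

lemma pth_rev: "pth A a p b \<Longrightarrow> pth A b (rev p) a"
  by (auto simp: pth_def flip_E hd_rev last_rev)

definition conn :: "'a set \<Rightarrow> 'a \<Rightarrow> 'a \<Rightarrow> bool" where
  "conn A = (\<lambda>u v. E u v \<and> u \<in> A \<and> v \<in> A)\<^sup>*\<^sup>*"

lemma conn_refl: "conn A a a"
  by (simp add: conn_def)

lemma conn_step: "conn A a b \<Longrightarrow> E b c \<Longrightarrow> b \<in> A \<Longrightarrow> c \<in> A \<Longrightarrow> conn A a c"
  unfolding conn_def by (rule rtranclp.rtrancl_into_rtrancl) auto

lemma conn_sym: "conn A a b \<Longrightarrow> conn A b a"
proof -
  have "symp (\<lambda>u v. E u v \<and> u \<in> A \<and> v \<in> A)"
    using E_sym by (auto simp: symp_def)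
  then show "conn A a b \<Longrightarrow> conn A b a"
    unfolding conn_def by (meson symp_rtranclp sympD)
qed

lemma conn_trans: "conn A a b \<Longrightarrow> conn A b c \<Longrightarrow> conn A a c"
  unfolding conn_def by simp

lemma conn_path:
  assumes "conn A a b" "a \<in> A"
  shows "\<exists>p. pth A a p b"
  using assms(1) unfolding conn_def
proof (induction rule: rtranclp_induct)
  case base
  then show ?case
    using assms(2) by (intro exI[of _ "[a]"]) (auto simp: pth_def)
next
  case (step b c)
  then obtain p where p: "pth A a p b" by blast
  show ?case
  proof (cases "c \<in> set p")
    case True
    then obtain q r where "p = q @ c # r"
      by (meson split_list)
    then have "pth A a (q @ [c]) c"
      using p by (cases q) (auto simp: pth_def successively_append_iff successively_Cons hd_append)
    then show ?thesis by blast
  next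
    case False
    then have "pth A a (p @ [c]) c"
      using p step by (auto simp: pth_def successively_append_iff)
    then show ?thesis by blast
  qed
qed

section \<open>Rerouting a longest cycle\<close>

text \<open>\<open>x\<close> and \<open>hd Z\<close> are consecutive on the cycle, so the outside
  path can be spliced in between them.\<close>

lemma insert_path:
  assumes "longest_cyc (x # Z)" "Z \<noteq> []" "pth (V - set (x # Z)) a p b" "E x a" "E b (hd Z)"
  shows False
proof -
  have "cyc (x # p @ Z)"
    using assms by (auto simp: longest_cyc_def cyc_def pth_def successively_append_iff successively_Cons)
  moreover have "p \<noteq> []"
    using assms(3) by (auto simp: pth_def)
  ultimately show False
    using longest_cycD[OF assms(1), of "x # p @ Z"] by auto
qed

text \<open>
  The longest cycle is \<open>x S y T\<close>, and \<open>P\<close> is a path outside it from a neighbour of \<open>x\<close> to a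
  neighbour of \<open>y\<close>. Thus \<open>hd S\<close>, \<open>last T\<close> are the cycle neighbours of \<open>x\<close>, and \<open>last S\<close>,
  \<open>hd T\<close> those of \<open>y\<close>.
\<close>

definition ear :: "'a \<Rightarrow> 'a list \<Rightarrow> 'a \<Rightarrow> 'a list \<Rightarrow> 'a list \<Rightarrow> bool" where
  "ear x S y T P \<longleftrightarrow> longest_cyc (x # S @ y # T) \<and>
     pth (V - set (x # S @ y # T)) (hd P) P (last P) \<and> E x (hd P) \<and> E (last P) y"

text \<open>Reading the cycle from \<open>y\<close> on exchanges the two attachments, and
  \<open>ear_mirror\<close> reverses the orientation. Between them they carry a fact about
  \<open>hd S\<close> over to the other three cycle neighbours.\<close>

lemma ear_swap: "ear x S y T P \<Longrightarrow> ear y T x S (rev P)"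
  using longest_cyc_rotate[of "x # S" "y # T"] pth_rev[of _ "hd P" P "last P"]
  unfolding ear_def
  by (auto simp: hd_rev last_rev Un_commute insert_commute E_commute)

lemma ear_mirror: "ear x S y T P \<Longrightarrow> ear x (rev T) y (rev S) P"
  using longest_cyc_rev[of "x # S @ y # T"] longest_cyc_rotate[of "[x]" "rev T @ y # rev S"]
  unfolding ear_def
  by (auto simp: Un_commute insert_commute)

text \<open>With \<open>S\<close> empty, \<open>x\<close> and \<open>y\<close> would be consecutive
  and \<open>P\<close> would fit between them.\<close>

lemma ear_nonempty1: "ear x S y T P \<Longrightarrow> S \<noteq> []"
  using insert_path[of x "S @ y # T" "hd P" P "last P"] by (cases S) (auto simp: ear_def)

lemma ear_nonempty2: "ear x S y T P \<Longrightarrow> T \<noteq> []"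
  using ear_nonempty1[OF ear_swap] .

text \<open>The common end of the reroutings: since \<open>P\<close> is nonempty, a cycle through
  \<open>P\<close> beats the longest one as soon as its remaining segment \<open>L\<close> is no
  shorter than \<open>S\<close> and \<open>T\<close> together.\<close>

lemma ear_longer:
  assumes "ear x S y T P" "cyc (x # P @ y # L)" "length S + length T \<le> length L"
  shows False
proof -
  have "P \<noteq> []"
    using assms(1) by (auto simp: ear_def pth_def)
  then show False
    using assms longest_cycD[of "x # S @ y # T" "x # P @ y # L"] by (cases P) (auto simp: ear_def)
qed

lemma earD:
  assumes "ear x S y T P"
  shows "S \<noteq> []" "T \<noteq> []" "P \<noteq> []"
    and "distinct (x # S @ y # T @ P)" "set (x # S @ y # T @ P) \<subseteq> V"
    and "successively E S" "successively E T" "successively E P"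
    and "E x (hd P)" "E (last P) y"
    and "E x (hd S)" "E (last S) y" "E y (hd T)" "E (last T) x"
  using assms ear_nonempty1[OF assms] ear_nonempty2[OF assms]
  by (auto simp: ear_def longest_cyc_def cyc_def pth_def successively_append_iff successively_Cons)

lemmas path_simps = successively_append_iff successively_Cons hd_append last_append hd_rev last_rev flip_E

text \<open>Such an edge would permit a crossing exchange: through \<open>P\<close> to
  \<open>y\<close>, backwards along \<open>S\<close>, over the edge, and forwards along
  \<open>T\<close> to \<open>x\<close>.\<close>

lemma ear_succ_succ:
  assumes "ear x S y T P"
  shows "\<not> E (hd S) (hd T)"
proof
  assume *: "E (hd S) (hd T)"
  have "cyc (x # P @ y # rev S @ T)"
    unfolding cyc_def
    using earD[OF assms] * E_sym[OF earD(12)[OF assms]]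
    by (auto simp: path_simps)
  then show False
    using ear_longer[OF assms, of "rev S @ T"] by simp
qed

lemma ear_pred_pred:
  assumes "ear x S y T P"
  shows "\<not> E (last S) (last T)"
  using ear_succ_succ[OF ear_mirror[OF assms]] ear_nonempty1[OF assms] ear_nonempty2[OF assms]
  by (simp add: hd_rev E_commute)

text \<open>Each of \<open>hd S\<close> and \<open>last T\<close> follows \<open>x\<close> in one of
  the two orientations of the cycle, where \<open>insert_path\<close> applies.\<close>

lemma ear_outside:
  assumes "ear x S y T P" "pth (V - set (x # S @ y # T)) a p b" "E x a"
  shows "\<not> E b (hd S)" "\<not> E b (last T)"
proof -
  show "\<not> E b (hd S)"
    using insert_path[of x "S @ y # T" a p b] assms earD(1)[OF assms(1)] by (auto simp: ear_def)
  have "ear x (rev T) y (rev S) P"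
    by (rule ear_mirror[OF assms(1)])
  moreover have "V - set (x # S @ y # T) = V - set (x # rev T @ y # rev S)"
    by auto
  ultimately show "\<not> E b (last T)"
    using insert_path[of x "rev T @ y # rev S" a p b] assms earD(2)[OF assms(1)]
    by (auto simp: ear_def hd_rev)
qed

lemma ear_exists:
  assumes "longest_cyc c" "x \<in> set c" "y \<in> set c" "x \<noteq> y"
    and "conn (V - set c) a b" "a \<in> V - set c" "E x a" "E b y"
  obtains S T P where "ear x S y T P" "set (x # S @ y # T) = set c" "hd P = a" "last P = b"
proof -
  obtain A B where c: "c = A @ x # B"
    using assms(2) by (meson split_list)
  then have "y \<in> set (B @ A)"
    using assms(3,4) by auto
  then obtain S T where ST: "B @ A = S @ y # T"
    by (meson split_list)
  have l: "longest_cyc (x # S @ y # T)"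
    using assms(1) longest_cyc_rotate[of A "x # B"] c ST by simp
  have s: "set (x # S @ y # T) = set c"
    using c ST by (metis Un_commute append_Cons set_append)
  obtain P where "pth (V - set c) a P b"
    using conn_path[OF assms(5,6)] by blast
  then show thesis
    using that[of S T P] l s assms(7,8) by (auto simp: ear_def pth_def)
qed

section \<open>Hamiltonian paths of vertex sets and cliques\<close>

definition hpath :: "'a set \<Rightarrow> 'a \<Rightarrow> 'a \<Rightarrow> bool" where
  "hpath A a b \<longleftrightarrow> (\<exists>p. pth A a p b \<and> set p = A)"

lemma hpath_join:
  assumes "hpath A a b" "hpath B c d" "E b c" "A \<inter> B = {}"
  shows "hpath (A \<union> B) a d"
proof -
  obtain p q where p: "pth A a p b" "set p = A" and q: "pth B c q d" "set q = B"
    using assms(1,2) by (auto simp: hpath_def)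
  then have "pth (A \<union> B) a (p @ q) d"
    using assms(3,4) by (auto simp: pth_def path_simps)
  then show ?thesis
    unfolding hpath_def using p q by (intro exI[of _ "p @ q"]) auto
qed

lemma hpath_sym: "hpath A a b \<Longrightarrow> hpath A b a"
  unfolding hpath_def using pth_rev by (metis set_rev)

lemma hpath_single: "hpath {a} a a"
  by (auto simp: hpath_def pth_def intro!: exI[of _ "[a]"])

definition clique :: "'a set \<Rightarrow> bool" where
  "clique K \<longleftrightarrow> (\<forall>u\<in>K. \<forall>v\<in>K. u \<noteq> v \<longrightarrow> E u v)"

lemma clique_subset: "clique K \<Longrightarrow> L \<subseteq> K \<Longrightarrow> clique L"
  by (auto simp: clique_def)

text \<open>Only the start is prescribed, because in a one-vertex clique the two ends
  coincide.\<close>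

lemma clique_hpath:
  assumes "clique K" "finite K" "a \<in> K"
  obtains b where "b \<in> K" "hpath K a b"
proof -
  have "\<exists>b\<in>K. hpath K a b"
    using assms(2,1,3)
  proof (induction "card K" arbitrary: K a)
    case 0
    then show ?case by simp
  next
    case (Suc n)
    show ?case
    proof (cases "K = {a}")
      case True
      then show ?thesis using hpath_single by blast
    next
      case False
      then obtain c where c: "c \<in> K - {a}"
        using Suc.prems by blast
      then obtain b where b: "b \<in> K - {a}" "hpath (K - {a}) c b"
        using Suc.hyps Suc.prems by (metis card_Diff_singleton clique_subset diff_Suc_1 finite_Diff Diff_subset)
      have "hpath ({a} \<union> (K - {a})) a b"
        using c Suc.prems by (intro hpath_join[OF hpath_single b(2)]) (auto simp: clique_def)
      then show ?thesis
        using b(1) Suc.prems(3) by (auto simp: insert_absorb)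
    qed
  qed
  then show thesis using that by blast
qed

lemma hpath_imp_cyc:
  assumes "hpath V a b" "E b a"
  obtains c where "cyc c" "set c = V"
  using assms that by (auto simp: hpath_def pth_def cyc_def)

text \<open>The closed neighbourhood: \<open>p\<close> and \<open>q\<close> dominate a set exactly
  if \<open>nbhd p \<union> nbhd q\<close> covers it.\<close>

definition nbhd :: "'a \<Rightarrow> 'a set" where
  "nbhd v = insert v {u. E v u}"

end

section \<open>Ears in claw-free graphs\<close>

locale claw_free_graph = finite_simple_graph +
  assumes claw: "E x a \<Longrightarrow> E x b \<Longrightarrow> E x c \<Longrightarrow> a \<noteq> b \<Longrightarrow> a \<noteq> c \<Longrightarrow> b \<noteq> c \<Longrightarrow>
    E a b \<or> E a c \<or> E b c"
begin

lemma ear_hd_P: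
  assumes "ear x S y T P"
  shows "\<not> E (hd P) (hd S)" "\<not> E (hd P) (last T)" "\<not> E (last P) (hd S)" "\<not> E (last P) (last T)"
proof -
  have P: "pth (V - set (x # S @ y # T)) (hd P) P (last P)" "E x (hd P)"
    using assms by (auto simp: ear_def)
  \<comment> \<open>The one-vertex path \<open>[hd P]\<close> serves the claims about
    \<open>hd P\<close>, the whole of \<open>P\<close> those about \<open>last P\<close>.\<close>
  then have "pth (V - set (x # S @ y # T)) (hd P) [hd P] (hd P)"
    by (cases P) (auto simp: pth_def)
  then show "\<not> E (hd P) (hd S)" "\<not> E (hd P) (last T)" "\<not> E (last P) (hd S)" "\<not> E (last P) (last T)"
    using ear_outside[OF assms] P by blast+
qed

lemma ear_neq:
  assumes "ear x S y T P"
  shows "hd S \<noteq> hd T" "hd S \<noteq> last T" "last S \<noteq> hd T" "last S \<noteq> last T"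
    and "hd P \<noteq> hd S" "hd P \<noteq> last T" "last P \<noteq> hd S" "last P \<noteq> hd T"
  using earD(1-4)[OF assms]
  by (auto simp: disjoint_iff) (metis hd_in_set last_in_set)+

text \<open>Otherwise \<open>y\<close> would be the centre of a claw with leaves
  \<open>last P\<close>, \<open>hd S\<close> and \<open>hd T\<close>.\<close>

lemma ear_succ_other:
  assumes "ear x S y T P"
  shows "\<not> E (hd S) y"
  using claw[of y "last P" "hd S" "hd T"] earD[OF assms] ear_hd_P[OF assms] ear_neq[OF assms]
    ear_succ_succ[OF assms] ear_hd_P[OF ear_swap[OF assms]] E_commute
  by (metis hd_rev)

lemma ear_nonadjacent:
  assumes "ear x S y T P"
  shows "\<not> E y (hd S)" "\<not> E x (hd T)" "\<not> E y (last T)" "\<not> E x (last S)"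
proof -
  show "\<not> E y (hd S)" "\<not> E x (hd T)"
    using ear_succ_other[OF assms] ear_succ_other[OF ear_swap[OF assms]] E_sym by blast+
  show "\<not> E y (last T)" "\<not> E x (last S)"
    using ear_succ_other[OF ear_mirror[OF assms]] ear_succ_other[OF ear_mirror[OF ear_swap[OF assms]]]
      earD(1,2)[OF assms] by (auto simp: hd_rev E_commute)
qed

text \<open>
  The successor of \<open>z\<close> on the cycle is adjacent to \<open>hd S\<close> or to \<open>hd T\<close>, as \<open>z\<close> is not the
  centre of a claw; in both cases the cycle can be rerouted through \<open>P\<close>.
\<close>

lemma ear_no_common_on_T:
  assumes e: "ear x S y T P" and "z \<in> set T"
    and z: "E z (hd S)" "E z (last S)" "E z (hd T) \<or> z = hd T" "E z (last T) \<or> z = last T"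
  shows False
proof -
  obtain T1 T2 where T: "T = T1 @ z # T2"
    using assms(2) by (meson split_list)
  have 1: "T1 \<noteq> []"
    using T z(1) ear_succ_succ[OF e] E_commute by (metis append_Nil list.sel(1))
  have 2: "T2 \<noteq> []"
    using T z(2) ear_pred_pred[OF e] E_commute by (metis last_snoc)
  note f = earD[OF e]
  have "E z (hd T2)" "hd T2 \<noteq> hd S" "hd T2 \<noteq> hd T" "z \<noteq> hd T"
    using f(1,4,7) 1 2 T
    by (auto simp: successively_append_iff successively_Cons disjoint_iff) (metis hd_in_set)+
  then have "E (hd T2) (hd S) \<or> E (hd T2) (hd T)"
    using claw[of z "hd T2" "hd S" "hd T"] z ear_neq(1)[OF e] ear_succ_succ[OF e] by blast
  then show False
  proof
    assume *: "E (hd T2) (hd S)"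
    have "cyc (x # P @ y # (T1 @ [z]) @ rev S @ T2)"
      unfolding cyc_def
      using f * z(2) E_sym[OF *] 1 2 by (auto simp: path_simps T)
    then show False
      using ear_longer[OF e, of "(T1 @ [z]) @ rev S @ T2"] by (simp add: T)
  next
    assume *: "E (hd T2) (hd T)"
    have "cyc (x # P @ y # rev S @ (z # rev T1) @ T2)"
      unfolding cyc_def
      using f * z(1) E_sym[OF *] E_sym[OF z(1)] E_sym[OF f(12)] 1 2
      by (auto simp: path_simps T E_commute)
    then show False
      using ear_longer[OF e, of "rev S @ (z # rev T1) @ T2"] by (simp add: T)
  qed
qed

text \<open>Earlier lemmas exclude that \<open>z\<close> lies on the cycle or on \<open>P\<close>. A
  vertex off both can stand in for the missing edge from \<open>hd S\<close> to \<open>hd T\<close>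
  in the exchange of \<open>ear_succ_succ\<close>.\<close>

lemma ear_no_common:
  assumes e: "ear x S y T P" and z: "{hd S, last S, hd T, last T} \<subseteq> nbhd z"
  shows False
proof -
  note f = earD[OF e]
  have hl: "hd S \<in> set S" "last S \<in> set S" "hd T \<in> set T" "last T \<in> set T"
    using f by auto
  have e': "ear y T x S (rev P)"
    by (rule ear_swap[OF e])
  have nn: "\<not> E (hd S) (hd T)" "\<not> E (hd T) (hd S)" "\<not> E (last S) (last T)" "\<not> E (last T) (last S)"
    using ear_succ_succ[OF e] ear_pred_pred[OF e] E_sym by blast+
  then have "z \<noteq> hd S" "z \<noteq> last S" "z \<noteq> hd T" "z \<noteq> last T"
    using ear_neq[OF e] z by (auto simp: nbhd_def)
  then have z': "E z (hd S)" "E z (last S)" "E z (hd T)" "E z (last T)"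
    using z by (auto simp: nbhd_def)
  have "z \<notin> set T"
    using ear_no_common_on_T[OF e] z' by blast
  moreover have "z \<notin> set S"
    using ear_no_common_on_T[OF e'] z' by blast
  moreover have "z \<noteq> x" "z \<noteq> y"
    using ear_nonadjacent[OF e] z' by blast+
  moreover have "z \<notin> set P"
  proof
    assume "z \<in> set P"
    then obtain P1 P2 where P: "P = P1 @ z # P2"
      by (meson split_list)
    then have "pth (V - set (x # S @ y # T)) (hd P) (P1 @ [z]) z"
      using e by (auto simp: ear_def pth_def path_simps)
    then show False
      using ear_outside[OF e] f(9) z' by blast
  qed
  moreover have "z \<in> V"
    using z' E_V by blast
  ultimately have "cyc (x # P @ y # rev S @ z # T)"
    unfolding cyc_def using f z' E_sym[OF z'(1)] E_sym[OF f(12)] by (auto simp: path_simps)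
  then show False
    using ear_longer[OF e, of "rev S @ z # T"] by simp
qed

text \<open>At \<open>x\<close>, the vertex \<open>hd P\<close> is adjacent neither to
  \<open>z\<close> nor to a cycle neighbour of \<open>x\<close>, so claw-freeness puts both cycle
  neighbours into \<open>nbhd z\<close>. The same holds at \<open>y\<close> with
  \<open>last P\<close>, which contradicts \<open>ear_no_common\<close>.\<close>

lemma ear_no_common_neighbour:
  assumes e: "ear x S y T P" and z: "E x z" "E y z" "z \<notin> nbhd (hd P)" "z \<notin> nbhd (last P)"
  shows False
proof -
  note f = earD[OF e] and h = ear_hd_P[OF e] ear_hd_P[OF ear_swap[OF e]]
  have z': "z \<noteq> hd P" "z \<noteq> last P" "\<not> E (hd P) z" "\<not> E (last P) z"
    using z by (auto simp: nbhd_def)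
  have h': "\<not> E (last P) (hd T)" "\<not> E (last P) (last S)"
    using h f(3) by (auto simp: hd_rev)
  have yl: "E y (last P)" "E y (last S)" "E x (last T)"
    using f E_sym by blast+
  have "hd S \<in> set S" "last S \<in> set S" "hd T \<in> set T" "last T \<in> set T" "hd P \<in> set P" "last P \<in> set P"
    using f by auto
  then have n: "hd P \<noteq> hd S" "hd P \<noteq> last T" "last P \<noteq> last S" "last P \<noteq> hd T"
    using f(4) by auto
  have "E z u \<or> u = z" if "E x u" "u \<noteq> hd P" "\<not> E (hd P) u" for u
    using claw[of x "hd P" z u] that z(1) z' f(9) by blast
  then have "hd S \<in> nbhd z" "last T \<in> nbhd z"
    using f(11) yl(3) n h(1,2) unfolding nbhd_def by fastforce+
  moreover have "E z u \<or> u = z" if "E y u" "u \<noteq> last P" "\<not> E (last P) u" for u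
    using claw[of y "last P" z u] that z(2) z' yl(1) by blast
  then have "last S \<in> nbhd z" "hd T \<in> nbhd z"
    using f(13) yl(2) n h' unfolding nbhd_def by fastforce+
  ultimately show False
    using ear_no_common[OF e, of z] by blast
qed

text \<open>The same cycle carries an ear between \<open>y\<close> and \<open>x\<close> and another
  between \<open>z\<close> and \<open>x\<close>. By \<open>ear_nonadjacent\<close> the first keeps
  \<open>x\<close> away from the cycle neighbours of \<open>y\<close>, the second from those of
  \<open>z\<close>.\<close>

lemma ear_third_attachment:
  assumes e: "ear y S z T P" and x: "x \<in> set S"
    and P1: "pth (V - set (y # S @ z # T)) a P1 b" "E y a" "E b x"
    and P2: "pth (V - set (y # S @ z # T)) c P2 d" "E z c" "E d x"
  shows "nbhd x \<inter> {hd S, last S, hd T, last T} = {}"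
proof -
  obtain S1 S2 where S: "S = S1 @ x # S2"
    using x by (meson split_list)
  have e1: "ear y S1 x (S2 @ z # T) P1"
    using e P1 by (auto simp: ear_def S pth_def)
  have "ear z T y S (rev P)"
    by (rule ear_swap[OF e])
  moreover have "V - set (y # S @ z # T) = V - set (z # T @ y # S)"
    by auto
  ultimately have e2: "ear z (T @ y # S1) x S2 P2"
    using P2 unfolding S by (auto simp: ear_def pth_def)
  note f1 = earD(1,2,4)[OF e1] and f2 = earD(1,2,4)[OF e2] and f = earD(1,2)[OF e]
  have "\<not> E x (hd S)" "\<not> E x (last T)" "\<not> E x (hd T)" "\<not> E x (last S)"
    using ear_nonadjacent(1,3)[OF e1] ear_nonadjacent(1,3)[OF e2] f1 f2 f by (auto simp: S)
  moreover have "hd S \<in> set S1" "last T \<in> set T" "hd T \<in> set T" "last S \<in> set S2"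
    using f1 f2 f by (auto simp: S)
  then have "x \<notin> {hd S, last S, hd T, last T}"
    using f1(3) f2(3) by auto
  ultimately show ?thesis
    by (auto simp: nbhd_def)
qed

end

section \<open>Critical pairs in 2-connected claw-free graphs\<close>

text \<open>A pair dominating \<open>V - {v}\<close> avoids \<open>nbhd v\<close>, as it would
  otherwise dominate the whole graph; its members may coincide. The connectivity assumption says
  that every cut of the graph without \<open>x\<close> is crossed by an edge.\<close>

locale critical_claw_free_graph = claw_free_graph +
  assumes crit: "v \<in> V \<Longrightarrow>
      \<exists>p\<in>V. \<exists>q\<in>V. p \<notin> nbhd v \<and> q \<notin> nbhd v \<and> V - {v} \<subseteq> nbhd p \<union> nbhd q"
    and two_connected: "x \<in> V \<Longrightarrow> A \<subseteq> V - {x} \<Longrightarrow> A \<noteq> {} \<Longrightarrow> A \<noteq> V - {x} \<Longrightarrow>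
      \<exists>a\<in>A. \<exists>b\<in>V - {x} - A. E a b"
    and card_V: "2 < card V"
begin

lemma nbhd_sym: "u \<in> nbhd v \<longleftrightarrow> v \<in> nbhd u"
  by (auto simp: nbhd_def E_commute)

text \<open>A member of the critical pair of \<open>u\<close> dominates \<open>v\<close>; it lies in
  \<open>nbhd v\<close> but not in \<open>nbhd u\<close>.\<close>

lemma nbhd_not_subset:
  assumes "u \<in> V" "v \<in> V" "u \<noteq> v"
  shows "\<not> nbhd v \<subseteq> nbhd u"
  using crit[OF assms(1)] assms nbhd_sym by blast

lemma claw_clique:
  assumes "E v a" "\<And>u. u \<in> K \<Longrightarrow> E v u \<and> u \<noteq> a \<and> \<not> E a u"
  shows "clique K"
  unfolding clique_def
proof (intro ballI impI)
  fix u w assume "u \<in> K" "w \<in> K" "u \<noteq> w"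
  then show "E u w"
    using claw[of v a u w] assms by blast
qed

text \<open>Some member of the critical pair of \<open>x\<close> dominates \<open>r\<close>, so it
  is \<open>r\<close>, \<open>x\<close> or \<open>y\<close>. The first two lie in
  \<open>nbhd x\<close>, hence the pair is \<open>y\<close> and some \<open>s\<close>.\<close>

lemma crit_at_neighbour_of_degree_2:
  assumes "\<And>z. E r z \<longleftrightarrow> z = x \<or> z = y"
  obtains s where "s \<in> V" "s \<notin> nbhd x" "V - {x} \<subseteq> nbhd y \<union> nbhd s"
proof -
  have rx: "E r x" "r \<noteq> x" "r \<in> V" "x \<in> V"
    using assms E_irrefl E_V by blast+
  obtain p q where pq: "p \<in> V" "q \<in> V" "p \<notin> nbhd x" "q \<notin> nbhd x" "V - {x} \<subseteq> nbhd p \<union> nbhd q"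
    using crit[OF rx(4)] by blast
  have "r \<in> nbhd p \<or> r \<in> nbhd q"
    using pq rx by blast
  moreover have "t = y" if "r \<in> nbhd t" "t \<notin> nbhd x" for t
  proof -
    have "t = r \<or> E r t"
      using that(1) E_sym by (auto simp: nbhd_def)
    moreover have "t \<noteq> x" "t \<noteq> r"
      using that(2) E_sym[OF rx(1)] by (auto simp: nbhd_def)
    ultimately show ?thesis
      using assms by blast
  qed
  ultimately have "p = y \<or> q = y"
    using pq by blast
  then show thesis
    using that pq by (auto simp: Un_commute)
qed

text \<open>Each clique is traversed from its end of the edge \<open>p q\<close> outwards, which
  leaves the outer ends free within \<open>X\<close> and \<open>Y\<close>.\<close>

lemma join_cliques:
  assumes "clique X" "clique Y" "X \<subseteq> V" "Y \<subseteq> V" "X \<inter> Y = {}" "p \<in> X" "q \<in> Y" "E p q"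
  obtains a b where "a \<in> X" "b \<in> Y" "hpath (X \<union> Y) a b"
proof -
  have "finite X" "finite Y"
    using assms finite_V finite_subset by blast+
  then obtain a b where "a \<in> X" "hpath X p a" "b \<in> Y" "hpath Y q b"
    using clique_hpath assms by metis
  then show thesis
    using that[of a b] hpath_join[OF hpath_sym] assms by blast
qed

lemma join_cliques_via:
  assumes "clique X" "clique Y" "X \<subseteq> V" "Y \<subseteq> V" "X \<inter> Y = {}" "p \<in> X" "q \<in> Y"
    and "hpath W c d" "E p c" "E d q" "W \<inter> (X \<union> Y) = {}"
  obtains a b where "a \<in> X" "b \<in> Y" "hpath (X \<union> Y \<union> W) a b"
proof -
  have "finite X" "finite Y"
    using assms finite_V finite_subset by blast+
  then obtain a b where ab: "a \<in> X" "hpath X p a" "b \<in> Y" "hpath Y q b"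
    using clique_hpath assms by metis
  have "hpath (X \<union> W) a d"
    using hpath_join[OF hpath_sym[OF ab(2)] assms(8,9)] assms(11) by blast
  then have "hpath ((X \<union> W) \<union> Y) a b"
    using hpath_join[OF _ ab(4)] assms(5,10,11) by blast
  then show thesis
    using that[of a b] ab by (simp add: Un_ac)
qed

section \<open>Hamiltonian cycles around one or two vertices of degree two\<close>

text \<open>It suffices to find a Hamiltonian path of \<open>X \<union> Y \<union> W\<close> from
  \<open>X\<close> to \<open>Y\<close>, since it closes up through \<open>y\<close>,
  \<open>r\<close>, \<open>x\<close>. Claws with leaf \<open>r\<close> make \<open>X\<close> and
  \<open>Y\<close> cliques; critical pairs control \<open>W\<close>.\<close>

lemma hamiltonian_if_degree_2:
  assumes r: "\<And>z. E r z \<longleftrightarrow> z = x \<or> z = y" and xy: "x \<noteq> y" "\<not> E x y"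
    and common: "\<And>z. E x z \<Longrightarrow> E y z \<Longrightarrow> z = r"
  obtains c where "cyc c" "set c = V"
proof -
  define X where "X = {z. E x z} - {r}"
  define Y where "Y = {z. E y z} - {r}"
  define W where "W = V - ({r, x, y} \<union> X \<union> Y)"
  have rxy: "r \<noteq> x" "r \<noteq> y" "E x r" "E y r" "\<not> E y x" "r \<in> V" "x \<in> V" "y \<in> V"
    using r xy E_irrefl E_commute E_V by blast+
  have V: "V = {x, r, y} \<union> (X \<union> Y \<union> W)" and sub: "X \<subseteq> V" "Y \<subseteq> V" "W \<subseteq> V"
    using rxy E_V by (auto simp: X_def Y_def W_def)
  have notin: "x \<notin> X" "y \<notin> X" "r \<notin> X" "x \<notin> Y" "y \<notin> Y" "r \<notin> Y" "x \<notin> W" "y \<notin> W" "r \<notin> W"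
    using xy rxy E_irrefl by (auto simp: X_def Y_def W_def)
  have disj: "X \<inter> Y = {}" "W \<inter> (X \<union> Y) = {}"
    using common by (auto simp: X_def Y_def W_def)
  have nr: "\<not> E r u" if "u \<in> X \<union> Y \<union> W" for u
    using that notin by (auto simp: r)
  have cX: "clique X"
    by (rule claw_clique[OF rxy(3)]) (use nr in \<open>auto simp: X_def\<close>)
  have cY: "clique Y"
    by (rule claw_clique[OF rxy(4)]) (use nr in \<open>auto simp: Y_def\<close>)
  have fin: "finite X" "finite Y" "finite W"
    using sub finite_V finite_subset by blast+
  have nx: "nbhd x = insert x (insert r X)" and ny: "nbhd y = insert y (insert r Y)"
    using rxy by (auto simp: nbhd_def X_def Y_def)
  have main: thesis if "a \<in> X" "b \<in> Y" "hpath (X \<union> Y \<union> W) a b" for a b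
  proof -
    have "E r x" "E x a" "E b y" "E y r"
      using that rxy by (auto simp: X_def Y_def r E_commute)
    then have "hpath (({r} \<union> {x}) \<union> (X \<union> Y \<union> W) \<union> {y}) r y"
      using that(3) notin rxy xy(1)
      by (intro hpath_join[OF hpath_join[OF hpath_join[OF hpath_single hpath_single]] hpath_single]) auto
    moreover have "({r} \<union> {x}) \<union> (X \<union> Y \<union> W) \<union> {y} = V"
      using V by auto
    ultimately show thesis
      using that hpath_imp_cyc \<open>E y r\<close> \<open>\<And>c. cyc c \<Longrightarrow> set c = V \<Longrightarrow> thesis\<close> by metis
  qed
  \<comment> \<open>The critical pair of \<open>r\<close> avoids \<open>{r, x, y}\<close> and must
    dominate \<open>x\<close> and \<open>y\<close>. So it meets both \<open>X\<close> and
    \<open>Y\<close>, which are disjoint.\<close>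
  obtain p q where pq: "p \<in> X" "q \<in> Y" "V - {r} \<subseteq> nbhd p \<union> nbhd q"
  proof -
    obtain p q where pq: "p \<in> V" "q \<in> V" "p \<notin> nbhd r" "q \<notin> nbhd r" "V - {r} \<subseteq> nbhd p \<union> nbhd q"
      using crit[OF rxy(6)] by blast
    have "p \<in> nbhd x \<or> q \<in> nbhd x" "p \<in> nbhd y \<or> q \<in> nbhd y"
      using pq rxy nbhd_sym by blast+
    moreover have "x \<in> nbhd r" "y \<in> nbhd r" "r \<in> nbhd r"
      using r by (auto simp: nbhd_def)
    ultimately have "p \<in> X \<or> q \<in> X" "p \<in> Y \<or> q \<in> Y"
      using pq unfolding nx ny by blast+
    then have "p \<in> X \<and> q \<in> Y \<or> q \<in> X \<and> p \<in> Y"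
      using disj by blast
    then show thesis
      using that[of p q] that[of q p] pq(5) by (auto simp: Un_commute)
  qed
  have r': "E r z \<longleftrightarrow> z = y \<or> z = x" for z
    using r by blast
  \<comment> \<open>The critical pair of \<open>x\<close> is \<open>y\<close> and \<open>s\<close>.
    As \<open>y\<close> dominates nothing in \<open>X \<union> W\<close>, all of that falls to
    \<open>s\<close>; likewise \<open>Y \<union> W\<close> falls to \<open>t\<close>.\<close>
  obtain s where s: "s \<in> V" "s \<notin> nbhd x" "V - {x} \<subseteq> nbhd y \<union> nbhd s"
    using crit_at_neighbour_of_degree_2[OF r] by metis
  obtain t where t: "t \<in> V" "t \<notin> nbhd y" "V - {y} \<subseteq> nbhd x \<union> nbhd t"
    using crit_at_neighbour_of_degree_2[OF r'] by metis
  have sE: "E s u" if "u \<in> X \<union> W" "u \<noteq> s" for u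
    using s(3) that notin disj sub unfolding ny by (auto simp: nbhd_def)
  have tE: "E t u" if "u \<in> Y \<union> W" "u \<noteq> t" for u
    using t(3) that notin disj sub unfolding nx by (auto simp: nbhd_def)
  have "s \<noteq> y"
    using sE[of p] pq(1) notin disj(1) by (auto simp: Y_def)
  then have sYW: "s \<in> Y \<union> W"
    using s(1,2) V unfolding nx by blast
  have "t \<noteq> x"
    using tE[of q] pq(2) notin disj(1) by (auto simp: X_def)
  then have tXW: "t \<in> X \<union> W"
    using t(1,2) V unfolding ny by blast
  consider "s \<in> Y" | "t \<in> X" | "s \<in> W" "t \<in> W"
    using sYW tXW by blast
  then show thesis
  proof cases
    case 1
    \<comment> \<open>Vertices of \<open>X \<union> W\<close> are neighbours of \<open>s\<close> not
      adjacent to \<open>y\<close>, so a non-edge among them would give a claw at \<open>s\<close>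
      with leaf \<open>y\<close>.\<close>
    have "E s y"
      using 1 E_sym by (simp add: Y_def)
    then have c: "clique (X \<union> W)"
    proof (rule claw_clique)
      fix u assume u: "u \<in> X \<union> W"
      then have "u \<notin> Y" "u \<noteq> r" "u \<noteq> y" "u \<noteq> s"
        using 1 disj notin by auto
      then show "E s u \<and> u \<noteq> y \<and> \<not> E y u"
        using sE[OF u] by (simp add: Y_def)
    qed
    obtain d where d: "d \<in> X \<union> W" "hpath (X \<union> W) p d"
      using clique_hpath[OF c, of p] fin pq by blast
    obtain b where b: "b \<in> Y" "hpath Y s b"
      using clique_hpath[OF cY, of s] fin 1 by blast
    have "E d s"
      using sE[of d] d 1 disj E_commute by blast
    then have "hpath ((X \<union> W) \<union> Y) p b"
      using hpath_join[OF d(2) b(2)] disj by blast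
    then show thesis
      using main[OF pq(1) b(1)] by (simp add: Un_ac)
  next
    case 2
    have "E t x"
      using 2 E_sym by (simp add: X_def)
    then have c: "clique (Y \<union> W)"
    proof (rule claw_clique)
      fix u assume u: "u \<in> Y \<union> W"
      then have "u \<notin> X" "u \<noteq> r" "u \<noteq> x" "u \<noteq> t"
        using 2 disj notin by auto
      then show "E t u \<and> u \<noteq> x \<and> \<not> E x u"
        using tE[OF u] by (simp add: X_def)
    qed
    obtain d where d: "d \<in> Y \<union> W" "hpath (Y \<union> W) q d"
      using clique_hpath[OF c, of q] fin pq by blast
    obtain b where b: "b \<in> X" "hpath X t b"
      using clique_hpath[OF cX, of t] fin 2 by blast
    have "E t d"
      using tE[of d] d 2 disj by blast
    then have "hpath (X \<union> (Y \<union> W)) b q"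
      using hpath_join[OF hpath_sym[OF b(2)] hpath_sym[OF d(2)]] disj by blast
    then show thesis
      using main[OF b(1) pq(2)] by (simp add: Un_ac)
  next
    case 3
    \<comment> \<open>\<open>p\<close> and \<open>q\<close> dominate \<open>W\<close>, so claws at
      \<open>p\<close> with leaf \<open>x\<close> and at \<open>q\<close> with leaf \<open>y\<close>
      make both \<open>Wp\<close> and \<open>Wq\<close> cliques.\<close>
    define Wp where "Wp = W \<inter> {u. E p u}"
    define Wq where "Wq = W - Wp"
    have Ep: "E p u" if "u \<in> Wp" for u
      using that by (auto simp: Wp_def)
    have Eq: "E u q" if "u \<in> Wq" for u
    proof -
      have "u \<in> nbhd p \<union> nbhd q" "u \<noteq> p" "u \<noteq> q" "\<not> E p u"
        using that pq sub notin disj unfolding Wq_def Wp_def by blast+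
      then show ?thesis
        by (auto simp: nbhd_def E_commute)
    qed
    have W: "W = Wp \<union> Wq" "Wp \<inter> Wq = {}"
      by (auto simp: Wp_def Wq_def)
    have nxW: "\<not> E x u \<and> u \<noteq> x \<and> \<not> E y u \<and> u \<noteq> y" if "u \<in> W" for u
      using that by (auto simp: W_def X_def Y_def)
    have px: "E p x" and qy: "E q y"
      using pq(1,2) by (auto simp: X_def Y_def E_commute)
    have c: "clique Wp" "clique Wq"
      using nxW Ep Eq E_sym W(1) by (blast intro: claw_clique[OF px] claw_clique[OF qy])+
    have fW: "finite Wp" "finite Wq"
      using fin W by auto
    have s1: "E p s" "\<And>u. u \<in> W \<Longrightarrow> u \<noteq> s \<Longrightarrow> E u s"
      using sE 3 pq disj E_commute by blast+
    have t1: "E t q"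
      using tE 3 pq disj by blast
    \<comment> \<open>\<open>Wp\<close> is entered from \<open>p\<close> and \<open>Wq\<close> is
      left towards \<open>q\<close>; \<open>s\<close>, adjacent to all other vertices of
      \<open>W\<close>, links the two. If one part is empty, \<open>t\<close> (adjacent to
      \<open>q\<close>) or \<open>s\<close> (adjacent to \<open>p\<close>) supplies the missing
      end.\<close>
    have "\<exists>c d. hpath W c d \<and> E p c \<and> E d q"
    proof -
      consider "Wq = {}" | "Wp = {}" | "s \<in> Wp" "Wq \<noteq> {}" | "s \<in> Wq" "Wp \<noteq> {}"
        using 3 W by blast
      then show ?thesis
      proof cases
        case 1
        then obtain e where "e \<in> Wp" "hpath W t e"
          using clique_hpath[OF c(1) fW(1), of t] 3 W by auto
        then show ?thesis
          using t1 Ep hpath_sym by blast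
      next
        case 2
        then obtain e where "e \<in> Wq" "hpath W s e"
          using clique_hpath[OF c(2) fW(2), of s] 3 W by auto
        then show ?thesis
          using s1 Eq by blast
      next
        case a: 3
        obtain e where e: "e \<in> Wp" "hpath Wp s e"
          using clique_hpath[OF c(1) fW(1) a(1)] by blast
        obtain f g where f: "f \<in> Wq" "g \<in> Wq" "hpath Wq f g"
          using clique_hpath[OF c(2) fW(2)] a by blast
        have "E s f"
          using s1(2)[of f] f a W E_commute by blast
        then have "hpath W e g"
          using hpath_join[OF hpath_sym[OF e(2)] f(3)] W by simp
        then show ?thesis
          using e f Ep Eq by blast
      next
        case a: 4
        obtain e where e: "e \<in> Wq" "hpath Wq s e"
          using clique_hpath[OF c(2) fW(2) a(1)] by blast
        obtain f g where f: "f \<in> Wp" "g \<in> Wp" "hpath Wp f g"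
          using clique_hpath[OF c(1) fW(1)] a by blast
        have "E g s"
          using s1(2)[of g] f a W by blast
        then have "hpath W f e"
          using hpath_join[OF f(3) e(2)] W by simp
        then show ?thesis
          using e f Ep Eq by blast
      qed
    qed
    then show thesis
      using join_cliques_via[OF cX cY sub(1,2) disj(1) pq(1,2)] disj(2) main by metis
  qed
qed

text \<open>As before, a Hamiltonian path of \<open>X \<union> Y \<union> W\<close> from
  \<open>X\<close> to \<open>Y\<close> closes up, now through \<open>y\<close>, \<open>w\<close>,
  \<open>v\<close>, \<open>x\<close>.\<close>

lemma hamiltonian_if_two_degree_2:
  assumes v: "\<And>z. E v z \<longleftrightarrow> z = x \<or> z = w" and w: "\<And>z. E w z \<longleftrightarrow> z = v \<or> z = y"
    and xy: "x \<noteq> y" "\<not> E x y" and common: "\<And>z. E x z \<Longrightarrow> \<not> E y z"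
  obtains c where "cyc c" "set c = V"
proof -
  define X where "X = {z. E x z} - {v}"
  define Y where "Y = {z. E y z} - {w}"
  define W where "W = V - ({v, w, x, y} \<union> X \<union> Y)"
  have e: "E x v" "E y w" "E v w" "\<not> E y x"
    using v w xy E_commute by blast+
  then have ne: "x \<noteq> v" "x \<noteq> w" "y \<noteq> v" "y \<noteq> w" "v \<noteq> w" "\<not> E x w" "\<not> E y v"
    using common xy E_irrefl E_commute by blast+
  have V: "V = {v, w, x, y} \<union> (X \<union> Y \<union> W)" and sub: "X \<subseteq> V" "Y \<subseteq> V" "W \<subseteq> V"
    using e E_V by (auto simp: X_def Y_def W_def)
  have notin: "x \<notin> X" "y \<notin> X" "v \<notin> X" "w \<notin> X" "x \<notin> Y" "y \<notin> Y" "v \<notin> Y" "w \<notin> Y"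
      "x \<notin> W" "y \<notin> W" "v \<notin> W" "w \<notin> W"
    using xy e ne E_irrefl by (auto simp: X_def Y_def W_def)
  have disj: "X \<inter> Y = {}" "W \<inter> (X \<union> Y) = {}"
    using common by (auto simp: X_def Y_def W_def)
  have nvw: "\<not> E v u \<and> \<not> E w u" if "u \<in> X \<union> Y \<union> W" for u
    using that notin by (auto simp: v w)
  have cX: "clique X"
    by (rule claw_clique[OF e(1)]) (use nvw in \<open>auto simp: X_def\<close>)
  have cY: "clique Y"
    by (rule claw_clique[OF e(2)]) (use nvw in \<open>auto simp: Y_def\<close>)
  have fin: "finite X" "finite Y" "finite W"
    using sub finite_V finite_subset by blast+
  have nx: "nbhd x = insert x (insert v X)" and ny: "nbhd y = insert y (insert w Y)"
    using e by (auto simp: nbhd_def X_def Y_def)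
  have main: thesis if "a \<in> X" "b \<in> Y" "hpath (X \<union> Y \<union> W) a b" for a b
  proof -
    have "E w v" "E v x" "E x a" "E b y" "E y w"
      using that e by (auto simp: X_def Y_def E_commute)
    then have "hpath ((({w} \<union> {v}) \<union> {x}) \<union> (X \<union> Y \<union> W) \<union> {y}) w y"
      using that(3) notin ne xy(1)
      by (intro hpath_join[OF hpath_join[OF hpath_join[OF
          hpath_join[OF hpath_single hpath_single] hpath_single]] hpath_single]) auto
    moreover have "(({w} \<union> {v}) \<union> {x}) \<union> (X \<union> Y \<union> W) \<union> {y} = V"
      using V by auto
    ultimately show thesis
      using that hpath_imp_cyc \<open>E y w\<close> \<open>\<And>c. cyc c \<Longrightarrow> set c = V \<Longrightarrow> thesis\<close> by metis
  qed
  have v': "E v z \<longleftrightarrow> z = w \<or> z = x" for z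
    using v by blast
  \<comment> \<open>The critical pairs of \<open>v\<close>, \<open>w\<close>, \<open>x\<close> are
    \<open>y, q\<close>, then \<open>x, t\<close>, then \<open>w, s\<close>. Since \<open>w\<close>
    dominates only \<open>v\<close>, \<open>w\<close>, \<open>y\<close>, the vertex \<open>s\<close>
    dominates all of \<open>X \<union> Y \<union> W\<close>.\<close>
  obtain q where q: "q \<in> V" "q \<notin> nbhd v" "V - {v} \<subseteq> nbhd y \<union> nbhd q"
    using crit_at_neighbour_of_degree_2[OF w] by metis
  obtain t where t: "t \<in> V" "t \<notin> nbhd w" "V - {w} \<subseteq> nbhd x \<union> nbhd t"
    using crit_at_neighbour_of_degree_2[OF v'] by metis
  obtain s where s: "s \<in> V" "s \<notin> nbhd x" "V - {x} \<subseteq> nbhd w \<union> nbhd s"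
    using crit_at_neighbour_of_degree_2[OF v] by metis
  have nw: "nbhd w = {w, v, y}" and nv: "nbhd v = {v, x, w}"
    using w v by (auto simp: nbhd_def)
  have "x \<in> V" "y \<in> V"
    using V by blast+
  then have "q \<in> nbhd x" "t \<in> nbhd y"
    using q t ne xy notin nbhd_sym[of x] nbhd_sym[of y] unfolding nx ny by blast+
  then have qX: "q \<in> X" and tY: "t \<in> Y"
    using q(2) t(2) unfolding nx ny nw nv by blast+
  have qE: "E q u" if "u \<in> X \<union> W" "u \<noteq> q" for u
    using q(3) that notin disj sub unfolding ny by (auto simp: nbhd_def)
  have tE: "E t u" if "u \<in> Y \<union> W" "u \<noteq> t" for u
    using t(3) that notin disj sub unfolding nx by (auto simp: nbhd_def)
  have sE: "E s u" if "u \<in> X \<union> Y \<union> W" "u \<noteq> s" for u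
    using s(3) that notin sub unfolding nw by (auto simp: nbhd_def)
  show thesis
  proof (cases "W = {}")
    case True
    \<comment> \<open>Without \<open>W\<close>, the vertex \<open>s\<close> lies in \<open>Y\<close>
      and \<open>q s\<close> is the edge that joins the two cliques.\<close>
    have "s \<noteq> w" "s \<noteq> y"
      using sE[of q] qX nvw notin disj by (auto simp: Y_def)
    then have "s \<in> Y"
      using s(1,2) V True unfolding nx by blast
    moreover have "E q s"
      using sE[of q] qX \<open>s \<in> Y\<close> disj E_commute by blast
    ultimately show thesis
      using join_cliques[OF cX cY sub(1,2) disj(1) qX] main True by (metis Un_empty_right)
  next
    case False
    then obtain f where f: "f \<in> W"
      by blast
    \<comment> \<open>A claw at \<open>q\<close> with leaf \<open>x\<close> is excluded, so
      \<open>W\<close> is a clique; it is entered from \<open>q\<close> and left towards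
      \<open>t\<close>.\<close>
    have "E q x"
      using qX E_sym by (simp add: X_def)
    then have c: "clique W"
    proof (rule claw_clique)
      fix u assume u: "u \<in> W"
      then have "u \<notin> X" "u \<noteq> v" "u \<noteq> x" "u \<noteq> q"
        using qX disj notin by auto
      then show "E q u \<and> u \<noteq> x \<and> \<not> E x u"
        using qE[of u] u by (simp add: X_def)
    qed
    obtain g where g: "g \<in> W" "hpath W f g"
      using clique_hpath[OF c fin(3) f] by blast
    have "E q f" "E g t"
      using qE[of f] tE[of g] f g qX tY disj E_commute by blast+
    then show thesis
      using join_cliques_via[OF cX cY sub(1,2) disj(1) qX tY g(2)] disj(2) main by metis
  qed
qed

section \<open>A component outside a longest cycle and its attachments\<close>

lemma spanning_cyc_exists:
  obtains c where "cyc c" "set c = V"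
proof -
  have "\<exists>u v. E u v"
  proof -
    obtain x where x: "x \<in> V"
      using card_V by fastforce
    have "card (V - {x}) > 1"
      using card_V x finite_V by simp
    then obtain y where "y \<in> V - {x}" "V - {x} \<noteq> {y}"
      by (metis One_nat_def card.empty card_1_singleton_iff all_not_in_conv less_irrefl not_less_zero)
    then show ?thesis
      using two_connected[OF x, of "{y}"] by blast
  qed
  then obtain c where c: "longest_cyc c"
    using longest_cyc_exists by blast
  show thesis
  proof (cases "set c = V")
    case True
    then show thesis
      using that c by (auto simp: longest_cyc_def)
  next
    case False
    define U where "U = V - set c"
    have cV: "set c \<subseteq> V"
      using c by (auto simp: longest_cyc_def cyc_def)
    then obtain r where r: "r \<in> U"
      using False by (auto simp: U_def)
    define R where "R = {u \<in> U. conn U r u}"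
    define A where "A = {x \<in> set c. \<exists>a\<in>R. E x a}"
    have RU: "R \<subseteq> U" "r \<in> R"
      using r conn_refl by (auto simp: R_def)
    have R_conn: "conn U a b" if "a \<in> R" "b \<in> R" for a b
      using that conn_trans[OF conn_sym, of U r a b] by (simp add: R_def)
    have R_step: "b \<in> R \<or> b \<in> A" if "a \<in> R" "E a b" for a b
    proof (cases "b \<in> U")
      case True
      then show ?thesis
        using that conn_step[of U r a b] by (auto simp: R_def)
    next
      case False
      then show ?thesis
        using that E_V[OF that(2)] E_sym[OF that(2)] by (auto simp: A_def U_def)
    qed
    have R_notin: "a \<notin> A" "a \<notin> set c" "a \<in> V" if "a \<in> R" for a
      using that RU by (auto simp: A_def U_def)
    have A_V: "x \<in> V" "x \<in> set c" if "x \<in> A" for x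
      using that cV by (auto simp: A_def)
    obtain x y where xy: "x \<in> A" "y \<in> A" "x \<noteq> y"
    proof -
      \<comment> \<open>If \<open>x\<close> were the only possible attachment, deleting it would cut
        \<open>R\<close> off from the other cycle vertices.\<close>
      have "\<not> A \<subseteq> {x}" if x: "x \<in> set c" for x
      proof
        assume A: "A \<subseteq> {x}"
        have "length c \<noteq> 1"
          using c E_irrefl by (auto simp: longest_cyc_def cyc_def length_Suc_conv)
        moreover have "distinct c"
          using c by (auto simp: longest_cyc_def cyc_def)
        ultimately have "set c \<noteq> {x}"
          using distinct_card[of c] by auto
        then obtain x' where x': "x' \<in> set c" "x' \<noteq> x"
          using x by blast
        have "R \<subseteq> V - {x}" "R \<noteq> {}" "R \<noteq> V - {x}"
          using R_notin RU x x' cV by blast+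
        then obtain a b where "a \<in> R" "b \<in> V - {x} - R" "E a b"
          using two_connected[of x R] x cV by blast
        then show False
          using R_step A by blast
      qed
      then have many: "\<exists>z\<in>A. z \<noteq> x" if "x \<in> set c" for x
        using that by blast
      have "hd c \<in> set c"
        using c by (simp add: longest_cyc_def cyc_def)
      then obtain y where "y \<in> A"
        using many by blast
      then show thesis
        using many[OF A_V(2)] that by blast
    qed
    have ear: "\<exists>S T P. ear x S y T P \<and> set (x # S @ y # T) = set c \<and> hd P = a \<and> last P = b"
      if "x \<in> A" "y \<in> A" "x \<noteq> y" "a \<in> R" "b \<in> R" "E x a" "E y b" for x y a b
      using ear_exists[OF c A_V(2)[OF that(1)] A_V(2)[OF that(2)] that(3), of a b]
        R_conn[OF that(4,5)] RU(1) that(4,6) E_sym[OF that(7)]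
      unfolding U_def by blast
    define ends where "ends S T = {hd S, last S, hd T, last T}" for S T :: "'a list"
    have ends_R: "nbhd z \<inter> ends S T = {}"
      if e: "ear x S y T P" "set (x # S @ y # T) = set c" and P: "hd P \<in> R" "last P \<in> R" and z: "z \<in> R"
      for x S y T P z
    proof -
      note f = earD[OF e(1)]
      obtain p1 where "pth U (hd P) p1 z"
        using conn_path[OF R_conn[OF P(1) z]] P RU by blast
      then have 1: "\<not> E z (hd S)" "\<not> E z (last T)"
        using ear_outside[OF e(1), of "hd P" p1 z] f e(2) by (auto simp: U_def)
      obtain p2 where "pth U (last P) p2 z"
        using conn_path[OF R_conn[OF P(2) z]] P RU by blast
      moreover have "set (y # T @ x # S) = set c"
        using e(2) by auto
      ultimately have 2: "\<not> E z (hd T)" "\<not> E z (last S)"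
        using ear_outside[OF ear_swap[OF e(1)], of "last P" p2 z] E_sym[OF f(10)] by (auto simp: U_def)
      have "z \<notin> set S" "z \<notin> set T"
        using R_notin(2)[OF z] e(2) by auto
      then show ?thesis
        using 1 2 f(1,2) by (auto simp: nbhd_def ends_def)
    qed
    have third: "nbhd x \<inter> ends S T = {}"
      if e: "ear y S z T P" "set (y # S @ z # T) = set c" and A: "x \<in> A" "y \<in> A" "z \<in> A" "x \<noteq> y" "x \<noteq> z"
      for x y z S T P
    proof -
      obtain a b d where abd: "a \<in> R" "b \<in> R" "d \<in> R" "E y a" "E z b" "E x d"
        using A by (auto simp: A_def)
      obtain p1 p2 where p: "pth U a p1 d" "pth U b p2 d"
        using conn_path[OF R_conn[OF abd(1,3)]] conn_path[OF R_conn[OF abd(2,3)]] abd(1,2) RU(1)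
        by (meson subsetD)
      have s: "set (z # T @ y # S) = set c"
        using e(2) by auto
      have "x \<in> set S \<or> x \<in> set T"
        using A_V(2)[OF A(1)] A e(2) by auto
      then show ?thesis
      proof
        assume "x \<in> set S"
        then show ?thesis
          unfolding ends_def
          by (rule ear_third_attachment[OF e(1) _ _ abd(4) E_sym[OF abd(6)] _ abd(5) E_sym[OF abd(6)]])
            (use p in \<open>simp_all only: e(2) U_def\<close>)
      next
        assume "x \<in> set T"
        then have "nbhd x \<inter> {hd T, last T, hd S, last S} = {}"
          by (rule ear_third_attachment[OF ear_swap[OF e(1)] _ _ abd(5) E_sym[OF abd(6)] _ abd(4) E_sym[OF abd(6)]])
            (use p in \<open>simp_all only: s U_def\<close>)
        then show ?thesis
          by (auto simp: ends_def)
      qed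
    qed
    \<comment> \<open>The four ends lie on the cycle, hence differ from \<open>v\<close>. If one
      member of the pair dominates none of them, the other dominates all four, against
      \<open>ear_no_common\<close>.\<close>
    have dom: False
      if e: "ear x S y T P" "set (x # S @ y # T) = set c" and v: "v \<in> R" "V - {v} \<subseteq> nbhd p \<union> nbhd q"
        and p: "nbhd p \<inter> ends S T = {}"
      for x S y T P v p q
    proof -
      have "ends S T \<subseteq> set c"
        unfolding e(2)[symmetric] using earD(1,2)[OF e(1)] by (auto simp: ends_def)
      then have "ends S T \<subseteq> V - {v}"
        using cV R_notin(2)[OF v(1)] by blast
      then have "ends S T \<subseteq> nbhd q"
        using v(2) p by blast
      then show False
        using ear_no_common[OF e(1)] by (auto simp: ends_def)
    qed
    have A_R: "\<exists>a\<in>R. E x a" if "x \<in> A" for x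
      using that by (auto simp: A_def)
    have A_ear: "\<exists>S T P. ear x S y T P \<and> set (x # S @ y # T) = set c \<and> hd P \<in> R \<and> last P \<in> R"
      if "x \<in> A" "y \<in> A" "x \<noteq> y" for x y
      using ear[OF that] A_R that by metis
    show thesis
    proof (cases "R = {r}")
      case True
      have Er: "E r z \<longleftrightarrow> z \<in> A" for z
        using R_step[of r z] A_R[of z] True E_irrefl E_sym by blast
      have rV: "r \<in> V" "r \<notin> A"
        using R_notin RU by auto
      have common: "z = r" if "x \<in> A" "y \<in> A" "x \<noteq> y" "E x z" "E y z" "z \<notin> A" for x y z
      proof (rule ccontr)
        assume "z \<noteq> r"
        then have "z \<notin> nbhd r"
          using Er that(6) by (auto simp: nbhd_def)
        then show False
          using A_ear[OF that(1-3)] True ear_no_common_neighbour that(4,5) by fastforce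
      qed
      obtain p q where pq: "p \<in> V" "q \<in> V" "p \<notin> nbhd r" "q \<notin> nbhd r" "V - {r} \<subseteq> nbhd p \<union> nbhd q"
        using crit[OF rV(1)] by blast
      then have pqA: "p \<notin> A" "q \<notin> A" "p \<noteq> r" "q \<noteq> r"
        using Er by (auto simp: nbhd_def)
      have dm: "E z p \<or> E z q" if "z \<in> A" for z
      proof -
        have "z \<in> nbhd p \<union> nbhd q"
          using that pq(5) A_V(1)[OF that] rV(2) by blast
        then show ?thesis
          using that pqA E_sym by (auto simp: nbhd_def)
      qed
      \<comment> \<open>Pigeonhole: of three attachments two would share \<open>p\<close> or
        \<open>q\<close> as a neighbour, and \<open>common\<close> would force it to be
        \<open>r\<close>.\<close>
      have A: "A = {x, y}"
      proof (rule ccontr)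
        assume "A \<noteq> {x, y}"
        then obtain z where "z \<in> A" "z \<noteq> x" "z \<noteq> y"
          using xy by blast
        then show False
          using dm[of x] dm[of y] dm[of z] xy common pqA by metis
      qed
      have "\<not> E x y"
      proof
        assume "E x y"
        then have "nbhd r \<subseteq> nbhd x"
          using Er A E_sym by (auto simp: nbhd_def)
        then show False
          using nbhd_not_subset[of x r] A_V(1) xy rV by blast
      qed
      moreover have "z = r" if "E x z" "E y z" for z
      proof -
        have "z \<notin> A"
          using that A \<open>\<not> E x y\<close> E_irrefl by blast
        then show ?thesis
          using common xy that by blast
      qed
      ultimately show thesis
        using hamiltonian_if_degree_2[of r x y] Er A xy(3) that by blast
    next
      case False
      \<comment> \<open>By \<open>ends_R\<close> and \<open>third\<close>, neither a vertex of
        \<open>R\<close> nor an attachment besides two others can belong to a critical pair. So if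
        \<open>t\<close> is an attachment, at most one more exists, and it is \<open>x\<close> or
        \<open>y\<close>.\<close>
      have D: "t \<notin> R \<and> (t \<in> A \<longrightarrow> A \<subseteq> {t, x} \<or> A \<subseteq> {t, y})"
        if v: "v \<in> R" "V - {v} \<subseteq> nbhd t \<union> nbhd s" for v t s
      proof (intro conjI impI notI)
        assume "t \<in> R"
        then show False
          using A_ear[OF xy] ends_R dom v by metis
      next
        assume t: "t \<in> A"
        have *: False if "z \<in> A" "w \<in> A" "z \<noteq> w" "t \<noteq> z" "t \<noteq> w" for z w
          using A_ear[OF that(1-3)] third t that dom v by metis
        show "A \<subseteq> {t, x} \<or> A \<subseteq> {t, y}"
          using * xy by blast
      qed
      \<comment> \<open>A second vertex \<open>u\<close> of \<open>R\<close> has to be dominated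
        from \<open>R\<close> or from \<open>A\<close>, and \<open>D\<close> rules out
        \<open>R\<close>.\<close>
      have D2: "p \<notin> R \<and> q \<notin> R \<and> A = {x, y} \<and> (p \<in> A \<or> q \<in> A)"
        if v: "v \<in> R" "V - {v} \<subseteq> nbhd p \<union> nbhd q" for v p q
      proof -
        have v': "V - {v} \<subseteq> nbhd q \<union> nbhd p"
          using v(2) by blast
        obtain u where u: "u \<in> R" "u \<noteq> v"
          using False v(1) RU by blast
        have "p \<notin> R" "q \<notin> R"
          using D[OF v(1)] v(2) v' by blast+
        moreover have "u \<in> nbhd p \<or> u \<in> nbhd q"
          using u R_notin(3) v(2) by blast
        then have "p \<in> A \<or> q \<in> A"
          using R_step[OF u(1)] calculation u(1) E_sym by (auto simp: nbhd_def)
        moreover have "A = {x, y}"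
          using D[OF v(1,2)] D[OF v(1) v'] calculation xy by blast
        ultimately show ?thesis by blast
      qed
      have A: "A = {x, y}"
        using crit[OF R_notin(3)[OF RU(2)]] D2[OF RU(2)] by blast
      \<comment> \<open>The critical pair of \<open>v\<close> avoids \<open>z\<close>, so
        \<open>z'\<close> is its only attachment. Only attachments in the pair can dominate the rest
        of \<open>R\<close>, so this falls to \<open>z'\<close>.\<close>
      have key: "R - {v} \<subseteq> {u. E z' u} \<and> \<not> E z' v"
        if v: "v \<in> R" "E z v" and z: "A = {z, z'}" "z \<noteq> z'" for v z z'
      proof -
        obtain p q where pq: "p \<in> V" "q \<in> V" "p \<notin> nbhd v" "q \<notin> nbhd v" "V - {v} \<subseteq> nbhd p \<union> nbhd q"
          using crit[OF R_notin(3)[OF v(1)]] by blast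
        note d = D2[OF v(1) pq(5)]
        have "p \<noteq> z" "q \<noteq> z"
          using pq E_sym[OF v(2)] by (auto simp: nbhd_def)
        then have "z' = p \<or> z' = q" and pqA: "p \<in> A \<Longrightarrow> p = z'" "q \<in> A \<Longrightarrow> q = z'"
          using d z by blast+
        then have "\<not> E z' v"
          using pq(3,4) E_sym by (auto simp: nbhd_def)
        moreover have "E z' u" if u: "u \<in> R" "u \<noteq> v" for u
        proof -
          have "u \<in> nbhd p \<or> u \<in> nbhd q"
            using u R_notin(3) pq(5) by blast
          then have "E p u \<and> p \<in> A \<or> E q u \<and> q \<in> A"
            using R_step[OF u(1)] d u(1) E_sym by (auto simp: nbhd_def)
          then show ?thesis
            using pqA by blast
        qed
        ultimately show ?thesis by blast
      qed
      obtain v w where vw: "v \<in> R" "E x v" "w \<in> R" "E y w"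
        using A_R xy by blast
      note kx = key[OF vw(1,2) A xy(3)]
      have A': "A = {y, x}"
        using A by blast
      note ky = key[OF _ _ A' xy(3)[symmetric]]
      have ne: "v \<noteq> w" "\<not> E y v" "\<not> E x w"
        using kx ky[OF vw(3,4)] vw by blast+
      \<comment> \<open>A further vertex \<open>u\<close> would be adjacent to \<open>y\<close> by
        \<open>kx\<close>; then \<open>ky\<close> at \<open>u\<close> would make \<open>x\<close>
        adjacent to \<open>w\<close>.\<close>
      have R: "R = {v, w}"
      proof -
        have "u = v \<or> u = w" if "u \<in> R" for u
          using kx ky[OF that] ne that vw by blast
        then show ?thesis
          using vw by blast
      qed
      obtain S T P where e: "ear x S y T P" "set (x # S @ y # T) = set c" "hd P = v" "last P = w"
        using ear[OF xy vw(1,3,2,4)] by blast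
      have vx: "E v z \<Longrightarrow> z = x \<or> z = w" and wy: "E w z \<Longrightarrow> z = y \<or> z = v" for z
        using R_step[of v z] R_step[of w z] R A ne E_irrefl E_sym by blast+
      have "E v w"
      proof (rule ccontr)
        assume "\<not> E v w"
        then have "nbhd v \<subseteq> nbhd x"
          using vx vw(2) by (auto simp: nbhd_def)
        then show False
          using nbhd_not_subset[of x v] A_V(1)[OF xy(1)] R_notin[OF vw(1)] xy(1) by blast
      qed
      then have deg: "\<And>z. E v z \<longleftrightarrow> z = x \<or> z = w" "\<And>z. E w z \<longleftrightarrow> z = v \<or> z = y"
        using vx wy E_sym[OF vw(2)] E_sym[OF vw(4)] E_sym[of v w] by blast+
      have "\<not> E x y"
      proof
        assume xy': "E x y"
        have "hd S \<in> set S" "hd P \<in> set P"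
          using earD(1,3)[OF e(1)] by auto
        then have "hd S \<noteq> v" "hd S \<noteq> y"
          using earD(4)[OF e(1)] e(3) by auto
        \<comment> \<open>Claw-freeness at \<open>x\<close> for \<open>v\<close>, \<open>y\<close>
          and \<open>hd S\<close>; each of the three possible edges is already excluded.\<close>
        then have "E v y \<or> E v (hd S) \<or> E y (hd S)"
          using claw[OF vw(2) xy' earD(11)[OF e(1)]] R_notin(1)[OF vw(1)] xy(2) by metis
        then show False
          using ne(2) ear_hd_P(1)[OF e(1)] ear_nonadjacent(1)[OF e(1)] e(3) E_sym by blast
      qed
      moreover have "\<not> E y z" if "E x z" for z
      proof
        assume yz: "E y z"
        have "z \<notin> {v, w, x, y}"
          using that yz ne E_irrefl by blast
        then have "z \<notin> nbhd v" "z \<notin> nbhd w"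
          using deg by (auto simp: nbhd_def)
        then show False
          using ear_no_common_neighbour[OF e(1) that yz] e(3,4) by blast
      qed
      ultimately show thesis
        using hamiltonian_if_two_degree_2[OF deg xy(3)] that by blast
    qed
  qed
qed

end

section \<open>Translation between digraphs and adjacency relations\<close>

lemma (in wf_digraph) awalk_of_path:
  assumes "successively (dominates G) (u # xs)" "u \<in> verts G"
  shows "\<exists>p. awalk u p (last (u # xs)) \<and> awalk_verts u p = u # xs"
  using assms
proof (induction xs arbitrary: u)
  case Nil
  then show ?case
    by (intro exI[of _ "[]"]) (simp add: awalk_Nil_iff)
next
  case (Cons v xs)
  then obtain e where e: "e \<in> arcs G" "tail G e = u" "head G e = v"
    by (auto elim: reachableE)
  then obtain p where "awalk v p (last (v # xs))" "awalk_verts v p = v # xs"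
    using Cons.IH[of v] Cons.prems head_in_verts[OF e(1)] by auto
  then show ?case
    using e by (intro exI[of _ "e # p"]) (simp add: awalk_Cons_iff)
qed

lemma (in wf_digraph) hamiltonianI:
  assumes c: "distinct c" "set c = verts G" "3 \<le> length c" "successively (dominates G) c"
    and closed: "last c \<rightarrow>\<^bsub>G\<^esub> hd c"
  shows "hamiltonian G"
proof -
  obtain u xs where u: "c = u # xs"
    using c(3) by (cases c) auto
  have "successively (dominates G) (u # (xs @ [u]))"
    using c(4) closed unfolding u by (auto simp: successively_append_iff successively_Cons hd_append split: if_splits)
  then obtain p where p: "awalk u p u" "awalk_verts u p = c @ [u]"
    using awalk_of_path[of u "xs @ [u]"] c(2) u by auto
  have ne: "p \<noteq> []"
    using p(2) u by auto
  \<comment> \<open>The vertices of a nonempty walk are the tails of its arcs followed by its end,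
    here the repeated \<open>u\<close>.\<close>
  then have "map (tail G) p = c"
    using p(2) by (simp add: awalk_verts_conv)
  then have "tail G ` set p = verts G" "3 \<le> length p"
    using c(2,3) by (metis set_map, metis length_map)
  moreover have "cycle p"
    unfolding cycle_def using p ne c(1) u by auto
  ultimately show ?thesis
    unfolding hamiltonian_def by blast
qed

lemma domination_number_le: "dominating_set G D \<Longrightarrow> finite D \<Longrightarrow> domination_number G \<le> card D"
  unfolding domination_number_def by (rule Least_le) blast

lemma domination_number_attained:
  assumes "finite (verts G)"
  obtains D where "dominating_set G D" "finite D" "card D = domination_number G"
proof -
  have "\<exists>D. dominating_set G D \<and> finite D \<and> card D = card (verts G)"
    using assms by (auto simp: dominating_set_def)
  then have "\<exists>D. dominating_set G D \<and> finite D \<and> card D = domination_number G"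
    unfolding domination_number_def by (rule LeastI)
  then show thesis
    using that by blast
qed

lemma (in graph) graph_induce_subgraph:
  assumes "S \<subseteq> verts G"
  shows "graph (G \<restriction> S)"
proof -
  interpret H: wf_digraph "G \<restriction> S"
    by (rule wellformed_induce_subgraph)
  have "symmetric (G \<restriction> S)"
    using induced_graph_imp_symmetric[OF sym_arcs induced_induce[OF assms]] .
  then show ?thesis
    using finite_subset[OF assms] no_loops no_multi_arcs
    by unfold_locales (auto simp: arc_to_ends_def)
qed

text \<open>If all three edges were missing, the arcs within \<open>{x, a, b, c}\<close> would be
  exactly those between \<open>x\<close> and the rest, so this set would induce a claw.\<close>

lemma (in graph) claw_freeD:
  assumes "claw_free G" "x \<rightarrow>\<^bsub>G\<^esub> a" "x \<rightarrow>\<^bsub>G\<^esub> b" "x \<rightarrow>\<^bsub>G\<^esub> c" "a \<noteq> b" "a \<noteq> c" "b \<noteq> c"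
  shows "a \<rightarrow>\<^bsub>G\<^esub> b \<or> a \<rightarrow>\<^bsub>G\<^esub> c \<or> b \<rightarrow>\<^bsub>G\<^esub> c"
proof (rule ccontr)
  assume no: "\<not> ?thesis"
  let ?S = "{x} \<union> {a, b, c}"
  have sym: "u \<rightarrow>\<^bsub>G\<^esub> v \<Longrightarrow> v \<rightarrow>\<^bsub>G\<^esub> u" for u v
    using arcs_ends_symmetric[OF sym_arcs] .
  have S: "?S \<subseteq> verts G"
    using assms adj_in_verts by blast
  have loop: "\<not> u \<rightarrow>\<^bsub>G\<^esub> u" for u
    using adj_not_same by blast
  then have x: "x \<notin> {a, b, c}"
    using assms by blast
  have non: "\<not> a \<rightarrow>\<^bsub>G\<^esub> b" "\<not> a \<rightarrow>\<^bsub>G\<^esub> c" "\<not> b \<rightarrow>\<^bsub>G\<^esub> c"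
    using no by blast+
  then have non_sym: "\<not> b \<rightarrow>\<^bsub>G\<^esub> a" "\<not> c \<rightarrow>\<^bsub>G\<^esub> a" "\<not> c \<rightarrow>\<^bsub>G\<^esub> b"
    using sym by blast+
  note adj_x = assms(2-4)[THEN sym]
  have "arcs_ends (G \<restriction> ?S) = arcs_ends G \<inter> ?S \<times> ?S"
    by (auto simp: arcs_ends_conv)
  also have "\<dots> = {x} \<times> {a, b, c} \<union> {a, b, c} \<times> {x}"
  proof (intro set_eqI)
    fix e
    show "e \<in> arcs_ends G \<inter> ?S \<times> ?S \<longleftrightarrow> e \<in> {x} \<times> {a, b, c} \<union> {a, b, c} \<times> {x}"
    proof (cases e)
      case (Pair u w)
      show ?thesis
      proof (cases "u \<in> ?S \<and> w \<in> ?S")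
        case True
        then show ?thesis
          unfolding Pair
          using x loop non non_sym assms(2-4) adj_x by (elim conjE UnE insertE emptyE) simp_all
      next
        case False
        then have "(u, w) \<notin> ?S \<times> ?S" "(u, w) \<notin> {x} \<times> {a, b, c} \<union> {a, b, c} \<times> {x}"
          by blast+
        then show ?thesis
          unfolding Pair by (simp only: Int_iff simp_thms)
      qed
    qed
  qed
  finally have "complete_bipartite_digraph 1 3 (G \<restriction> ?S)"
    unfolding complete_bipartite_digraph_def
    using graph_induce_subgraph[OF S] x assms(5-7)
    by (intro conjI exI[of _ "{x}"] exI[of _ "{a, b, c}"]) simp_all
  then show False
    using assms(1) induced_induce[OF S] unfolding claw_free_def by blast
qed

text \<open>A minimum dominating set of the graph without \<open>v\<close> has one or two elements
  and so cannot dominate the whole graph. The vertex it misses can only be \<open>v\<close>.\<close>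

lemma (in graph) critical_pair:
  assumes "domination_vertex_critical 3 G" "2 < card (verts G)" "v \<in> verts G"
  obtains p q where "p \<in> verts G" "q \<in> verts G"
    "p \<notin> insert v {u. v \<rightarrow>\<^bsub>G\<^esub> u}" "q \<notin> insert v {u. v \<rightarrow>\<^bsub>G\<^esub> u}"
    "verts G - {v} \<subseteq> insert p {u. p \<rightarrow>\<^bsub>G\<^esub> u} \<union> insert q {u. q \<rightarrow>\<^bsub>G\<^esub> u}"
proof -
  have sym: "u \<rightarrow>\<^bsub>G\<^esub> w \<Longrightarrow> w \<rightarrow>\<^bsub>G\<^esub> u" for u w
    using arcs_ends_symmetric[OF sym_arcs] .
  let ?H = "del_vert v"
  have V: "verts ?H = verts G - {v}"
    by (simp add: verts_del_vert)
  obtain D where D: "dominating_set ?H D" "finite D" "card D = domination_number ?H"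
    using domination_number_attained[of ?H] V by auto
  have D2: "card D \<le> 2"
    using D(3) assms(1,3) by (force simp: domination_vertex_critical_def)
  have "D \<subseteq> verts G - {v}"
    using D(1) V by (auto simp: dominating_set_def)
  have "arcs_ends ?H \<subseteq> arcs_ends G"
    by (auto simp: arcs_ends_conv del_vert_simps)
  then have dom: "\<exists>u\<in>D. u = w \<or> u \<rightarrow>\<^bsub>G\<^esub> w" if "w \<in> verts G - {v}" for w
    using D(1) that sym unfolding dominating_set_def V by blast
  have "verts G - {v} \<noteq> {}"
  proof
    assume "verts G - {v} = {}"
    then have "card (verts G) \<le> card {v}"
      by (intro card_mono) auto
    then show False
      using assms(2) by simp
  qed
  then have "D \<noteq> {}"
    using dom by blast
  then have "card D = 1 \<or> card D = 2"
    using D(2) D2 by (metis card_0_eq One_nat_def le_SucE le_zero_eq numeral_2_eq_2)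
  then obtain p q where pq: "D = {p, q}"
    by (auto simp: card_1_singleton_iff card_2_iff)
  have "\<not> dominating_set G D"
    using domination_number_le[of G D] D(2) D2 assms(1) by (auto simp: domination_vertex_critical_def)
  then obtain w where w: "w \<in> verts G - D" "\<And>u. u \<in> D \<Longrightarrow> \<not> w \<rightarrow>\<^bsub>G\<^esub> u"
    using \<open>D \<subseteq> verts G - {v}\<close> unfolding dominating_set_def by blast
  then have "w = v"
    using dom[of w] sym by blast
  then show thesis
    using that[of p q] w dom \<open>D \<subseteq> verts G - {v}\<close> unfolding pq by blast
qed

lemma (in graph) edge_across:
  assumes "connected (G \<restriction> S)" "A \<subseteq> S" "A \<noteq> {}" "A \<noteq> S"
  shows "\<exists>a\<in>A. \<exists>b\<in>S - A. a \<rightarrow>\<^bsub>G\<^esub> b"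
proof (rule ccontr)
  assume no: "\<not> ?thesis"
  obtain a b where ab: "a \<in> A" "b \<in> S - A"
    using assms by blast
  have sym: "u \<rightarrow>\<^bsub>G\<^esub> w \<Longrightarrow> w \<rightarrow>\<^bsub>G\<^esub> u" for u w
    using arcs_ends_symmetric[OF sym_arcs] .
  let ?F = "parcs (mk_symmetric (G \<restriction> S))"
  have F: "u \<rightarrow>\<^bsub>G\<^esub> w \<and> w \<in> S" if "(u, w) \<in> ?F" for u w
    using that sym by (fastforce simp: parcs_mk_symmetric arcs_ends_conv)
  \<comment> \<open>\<open>connected\<close> means strong connectedness of the symmetric closure; a
    path there that starts in \<open>A\<close> can never leave it, as no edge does.\<close>
  have "(a, b) \<in> rtrancl_on S ?F"
    using assms(1,2) ab
    by (force simp: connected_def strongly_connected_def reachable_def)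
  then have "(a, b) \<in> ?F\<^sup>*"
    by (rule rtrancl_on_rtranclI)
  then have "b \<in> A"
    using ab(1) no F by (induction rule: rtrancl_induct) blast+
  then show False
    using ab(2) by blast
qed

theorem theorem2p9:
  fixes G :: "('a, 'b) pre_digraph"
  assumes "graph G"
    and "k_connected 2 G"
    and "domination_vertex_critical 3 G"
    and "claw_free G"
  shows "hamiltonian G"
proof -
  interpret graph G
    by (rule assms(1))
  have card: "2 < card (verts G)"
    using assms(2) by (simp add: k_connected_def)
  have conn: "connected (G \<restriction> (verts G - {x}))" if "x \<in> verts G" for x
    using assms(2) that unfolding k_connected_def by force
  interpret F: finite_simple_graph "verts G" "dominates G"
    using arcs_ends_symmetric[OF sym_arcs] adj_not_same adj_in_verts
    by unfold_locales auto
  interpret C: critical_claw_free_graph "verts G" "dominates G"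
  proof unfold_locales
    fix v assume "v \<in> verts G"
    then show "\<exists>p\<in>verts G. \<exists>q\<in>verts G. p \<notin> F.nbhd v \<and> q \<notin> F.nbhd v \<and>
        verts G - {v} \<subseteq> F.nbhd p \<union> F.nbhd q"
      unfolding F.nbhd_def using critical_pair[OF assms(3) card] by metis
  next
    fix x A
    assume "x \<in> verts G" "A \<subseteq> verts G - {x}" "A \<noteq> {}" "A \<noteq> verts G - {x}"
    then show "\<exists>a\<in>A. \<exists>b\<in>verts G - {x} - A. a \<rightarrow>\<^bsub>G\<^esub> b"
      using edge_across conn by blast
  qed (use claw_freeD[OF assms(4)] card in blast)+
  obtain c where c: "F.cyc c" "set c = verts G"
    using C.spanning_cyc_exists by blast
  show ?thesis
    using c card distinct_card[of c] by (intro hamiltonianI[of c]) (auto simp: F.cyc_def)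
qed

end
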